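(* Let $\Omega$ be a finite set and let $P=\{\mathsf{B}_1,\ldots,\mathsf{B}_s\}$ be a strongly regular partition of $\mathcal{P}(\Omega)$. For any two blocs $\mathsf{B}_i$ and $\mathsf{B}_j$ of $P$, the number of members of $\mathsf{B}_j$ that contain a member $A$ of $\mathsf{B}_i$ is independent of the choice of $A$ in $\mathsf{B}_i$. Moreover, this number is equal to $$\frac{\binom{\Omega}{\mathsf{B}_j}}{\binom{\Omega}{\mathsf{B}_i}}\binom{\mathsf{B}_j}{\mathsf{B}_i}$$ and to $\binom{\mathsf{B}_{c(i)}}{\mathsf{B}_{c(j)}}$.
   Context: $\mathcal{P}(\Omega)$ is the powerset of $\Omega$. A strongly regular partition of $\mathcal{P}(\Omega)$ is a partition of $\mathcal{P}(\Omega)$ into (nonempty) blocs $\mathsf{B}_1,\ldots,\mathsf{B}_s$ such that: (1) all sets in a given bloc have the same size; (2) for any bloc $\mathsf{B}_i$, the set of all complements (in $\Omega$) of the members of $\mathsf{B}_i$ is also a bloc, denoted $\mathsf{B}_{c(i)}$; (3) for any two blocs $\mathsf{B}_i$ and $\mathsf{B}_j$, the number of members of $\mathsf{B}_j$ that are included in a member $A$ of $\mathsf{B}_i$ is independent of the choice of $A$ in $\mathsf{B}_i$; this number is denoted $\binom{\mathsf{B}_i}{\mathsf{B}_j}$. The notation $\binom{\Omega}{\mathsf{B}_j}$ denotes the number of members of $\mathsf{B}_j$ included in $\Omega$, i.e. the number of sets in $\mathsf{B}_j$. *)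

theory Defs
  imports Complex_Main "HOL-Library.Disjoint_Sets"
begin

definition compl_bloc :: "'a set \<Rightarrow> 'a set set \<Rightarrow> 'a set set" where
  "compl_bloc \<Omega> B = (\<lambda>X. \<Omega> - X) ` B"

definition set_binom :: "'a set \<Rightarrow> 'a set set \<Rightarrow> nat" where
  "set_binom A B = card {X \<in> B. X \<subseteq> A}"

text \<open>A partition is represented by its set of blocs; \<^const>\<open>partition_on\<close> makes the
  blocs nonempty.\<close>

definition strongly_regular_partition :: "'a set \<Rightarrow> 'a set set set \<Rightarrow> bool" where
  "strongly_regular_partition \<Omega> P \<longleftrightarrow>
     partition_on (Pow \<Omega>) P \<and>
     (\<forall>B\<in>P. \<forall>X\<in>B. \<forall>Y\<in>B. card X = card Y) \<and>
     (\<forall>B\<in>P. compl_bloc \<Omega> B \<in> P) \<and>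
     (\<forall>B\<in>P. \<forall>C\<in>P. \<forall>X\<in>B. \<forall>Y\<in>B. set_binom X C = set_binom Y C)"

text \<open>The common value of \<open>set_binom A C\<close> over all \<open>A \<in> B\<close>; it is only meaningful for
  blocs \<open>B\<close> and \<open>C\<close> of a strongly regular partition, where it exists and is unique.\<close>

definition bloc_binom :: "'a set set \<Rightarrow> 'a set set \<Rightarrow> nat" where
  "bloc_binom B C = (THE n. \<forall>A\<in>B. set_binom A C = n)"

end

theory Submission
  imports Defs
begin

text \<open>
  Complementation reverses inclusion, so the members of \<open>C\<close> that contain \<open>A\<close> correspond to
  the members of the complementary bloc of \<open>C\<close> that are included in \<open>\<Omega> - A\<close>
  (\<open>card_supersets_eq_set_binom_compl\<close>). As \<open>A\<close> runs over the bloc \<open>B\<close>, the set \<open>\<Omega> - A\<close> runs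
  over a bloc too, so the regularity condition on included members makes this number
  constant, say \<open>n\<close>, and identifies it with the coefficient of the complementary blocs.

  The quotient formula is a double count of the pairs \<open>(A, X)\<close> with \<open>A \<in> B\<close>, \<open>X \<in> C\<close> and
  \<open>A \<subseteq> X\<close>: counted by \<open>A\<close> they number \<open>n\<close> times the size of \<open>B\<close>, counted by \<open>X\<close> they number
  the coefficient of \<open>C\<close> over \<open>B\<close> times the size of \<open>C\<close>. The formula follows on dividing by the
  size of \<open>B\<close>, which is positive because blocs are nonempty.
\<close>

lemma
  assumes "strongly_regular_partition \<Omega> P"
  shows strongly_regular_partition_on: "partition_on (Pow \<Omega>) P"
    and compl_bloc_mem: "B \<in> P \<Longrightarrow> compl_bloc \<Omega> B \<in> P"
    and set_binom_const: "B \<in> P \<Longrightarrow> C \<in> P \<Longrightarrow> X \<in> B \<Longrightarrow> Y \<in> B \<Longrightarrow> set_binom X C = set_binom Y C"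
proof -
  note parts = assms[unfolded strongly_regular_partition_def]
  show "partition_on (Pow \<Omega>) P"
    by (rule conjunct1[OF parts])
  have "\<forall>B\<in>P. compl_bloc \<Omega> B \<in> P"
    by (rule conjunct1[OF conjunct2[OF conjunct2[OF parts]]])
  then show "B \<in> P \<Longrightarrow> compl_bloc \<Omega> B \<in> P"
    by (rule bspec)
  show "set_binom X C = set_binom Y C" if "B \<in> P" "C \<in> P" "X \<in> B" "Y \<in> B"
    by (rule conjunct2[OF conjunct2[OF conjunct2[OF parts]], THEN bspec, THEN bspec,
          THEN bspec, THEN bspec, OF that])
qed

lemma bloc_binom_eq_set_binom:
  assumes "strongly_regular_partition \<Omega> P" "B \<in> P" "C \<in> P" "A \<in> B"
  shows "bloc_binom B C = set_binom A C"
  unfolding bloc_binom_def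
proof (rule the_equality)
  show "\<forall>X\<in>B. set_binom X C = set_binom A C"
    by (intro ballI set_binom_const[OF assms(1-3) _ assms(4)])
  show "n = set_binom A C" if "\<forall>X\<in>B. set_binom X C = n" for n
    using that assms(4) by simp
qed

lemma bloc_subset_Pow:
  assumes "strongly_regular_partition \<Omega> P" "B \<in> P"
  shows "B \<subseteq> Pow \<Omega>"
  using partition_onD1[OF strongly_regular_partition_on[OF assms(1)]] assms(2) by blast

lemma set_binom_eq_card:
  assumes "C \<subseteq> Pow \<Omega>"
  shows "set_binom \<Omega> C = card C"
  unfolding set_binom_def using assms by (intro arg_cong[where f = card]) auto

text \<open>The correspondence is \<open>X \<mapsto> \<Omega> - X\<close>, which is an involution on the subsets of \<open>\<Omega>\<close> and
  reverses inclusion.\<close>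

lemma card_supersets_eq_set_binom_compl:
  assumes "A \<subseteq> \<Omega>" "C \<subseteq> Pow \<Omega>"
  shows "card {X \<in> C. A \<subseteq> X} = set_binom (\<Omega> - A) (compl_bloc \<Omega> C)"
proof -
  have "bij_betw (\<lambda>X. \<Omega> - X) {X \<in> C. A \<subseteq> X} {Y \<in> compl_bloc \<Omega> C. Y \<subseteq> \<Omega> - A}"
  proof (rule bij_betw_imageI)
    show "inj_on (\<lambda>X. \<Omega> - X) {X \<in> C. A \<subseteq> X}"
    proof (rule inj_on_inverseI)
      show "\<Omega> - (\<Omega> - X) = X" if "X \<in> {X \<in> C. A \<subseteq> X}" for X
        using that assms(2) by (intro double_diff) auto
    qed
    have "\<Omega> - X \<subseteq> \<Omega> - A \<longleftrightarrow> A \<subseteq> X" for X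
      using assms(1) by auto
    then show "(\<lambda>X. \<Omega> - X) ` {X \<in> C. A \<subseteq> X} = {Y \<in> compl_bloc \<Omega> C. Y \<subseteq> \<Omega> - A}"
      unfolding compl_bloc_def by auto
  qed
  then show ?thesis
    unfolding set_binom_def by (rule bij_betw_same_card)
qed

theorem lemma1:
  fixes \<Omega> :: "'a set" and P :: "'a set set set" and B C :: "'a set set"
  assumes "finite \<Omega>"
    and "strongly_regular_partition \<Omega> P"
    and "B \<in> P" and "C \<in> P"
  shows "\<exists>n::nat. (\<forall>A\<in>B. card {X \<in> C. A \<subseteq> X} = n) \<and>
           real n = real (set_binom \<Omega> C) / real (set_binom \<Omega> B) * real (bloc_binom C B) \<and>
           n = bloc_binom (compl_bloc \<Omega> B) (compl_bloc \<Omega> C)"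
proof -
  define n where "n = bloc_binom (compl_bloc \<Omega> B) (compl_bloc \<Omega> C)"
  have B: "B \<subseteq> Pow \<Omega>" and C: "C \<subseteq> Pow \<Omega>"
    using bloc_subset_Pow[OF assms(2)] assms(3,4) by simp_all
  have fin: "finite B" "finite C"
    using finite_subset[OF B] finite_subset[OF C] assms(1) by simp_all
  have "B \<noteq> {}"
    using partition_onD3[OF strongly_regular_partition_on[OF assms(2)]] assms(3) by blast
  then have B_pos: "card B > 0"
    using fin(1) by (simp add: card_gt_0_iff)
  have compl: "compl_bloc \<Omega> B \<in> P" "compl_bloc \<Omega> C \<in> P"
    by (rule compl_bloc_mem[OF assms(2)], fact)+

  have n_eq: "card {X \<in> C. A \<subseteq> X} = n" if "A \<in> B" for A
  proof -
    have "\<Omega> - A \<in> compl_bloc \<Omega> B"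
      unfolding compl_bloc_def using that by (rule imageI)
    then have "n = set_binom (\<Omega> - A) (compl_bloc \<Omega> C)"
      unfolding n_def by (rule bloc_binom_eq_set_binom[OF assms(2) compl])
    then show ?thesis
      using card_supersets_eq_set_binom_compl[OF _ C] that B by auto
  qed

  have "n * card B = (\<Sum>A\<in>B. card {X \<in> C. A \<subseteq> X})"
    using n_eq by simp
  also have "\<dots> = bloc_binom C B * card C"
  proof (rule sum_multicount[OF fin])
    show "\<forall>X\<in>C. card {A \<in> B. A \<subseteq> X} = bloc_binom C B"
      using bloc_binom_eq_set_binom[OF assms(2,4,3)] by (simp add: set_binom_def)
  qed
  finally have "real n * real (card B) = real (bloc_binom C B) * real (card C)"
    by (metis of_nat_mult)
  then have "real n = real (set_binom \<Omega> C) / real (set_binom \<Omega> B) * real (bloc_binom C B)"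
    using B_pos by (simp add: set_binom_eq_card[OF B] set_binom_eq_card[OF C] field_simps)
  then show ?thesis
    using n_eq n_def by (intro exI[of _ n]) simp
qed

end
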